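(* Let $G=(V,E)$ be a connected graph, and let $k\ge 2$ be an integer. There exists a matching-$k$-cover in $G$ if and only if $|S|\le k\,|N(S)|$ for each stable set $S$ of $G$.
   Context: Graphs are finite and simple (no loops or parallel edges). A matching is a set of pairwise node-disjoint edges (possibly empty). An edge set covers a node if some edge of the set is incident to that node; a family of edge sets covers the nodes covered by its union. A matching-$k$-cover of $G=(V,E)$ is a collection of $k$ matchings of $G$ that covers all of $V$. A stable set is a set of pairwise non-adjacent nodes (possibly empty). For $U\subseteq V$, $N(U)=\{v\in V\setminus U:\text{ there exists }u\in U\text{ with }uv\in E\}$. *)

theory Defs
  imports Main
begin

text \<open>An edge is the two-element set of its ends, which excludes loops and parallel edges.\<close>

definition simple_graph :: "'a set \<Rightarrow> 'a set set \<Rightarrow> bool" where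
  "simple_graph V E \<longleftrightarrow> finite V \<and> (\<forall>e\<in>E. e \<subseteq> V \<and> card e = 2)"

text \<open>The graph without nodes is not excluded.\<close>

definition connected_graph :: "'a set \<Rightarrow> 'a set set \<Rightarrow> bool" where
  "connected_graph V E \<longleftrightarrow> simple_graph V E \<and>
     (\<forall>u\<in>V. \<forall>v\<in>V. (u, v) \<in> {(x, y). {x, y} \<in> E}\<^sup>*)"

definition matching_in :: "'a set set \<Rightarrow> 'a set set \<Rightarrow> bool" where
  "matching_in E M \<longleftrightarrow> M \<subseteq> E \<and> pairwise disjnt M"

definition covers :: "'a set set \<Rightarrow> 'a \<Rightarrow> bool" where
  "covers F v \<longleftrightarrow> (\<exists>e\<in>F. v \<in> e)"

text \<open>A collection of k matchings is a family indexed by \<open>{..<k}\<close>, so a matching may be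
  repeated; the values of \<open>M\<close> at other indices play no role.\<close>

definition matching_cover :: "nat \<Rightarrow> 'a set \<Rightarrow> 'a set set \<Rightarrow> (nat \<Rightarrow> 'a set set) \<Rightarrow> bool" where
  "matching_cover k V E M \<longleftrightarrow>
     (\<forall>i<k. matching_in E (M i)) \<and> (\<forall>v\<in>V. covers (\<Union>i<k. M i) v)"

definition stable_set :: "'a set \<Rightarrow> 'a set set \<Rightarrow> 'a set \<Rightarrow> bool" where
  "stable_set V E S \<longleftrightarrow> S \<subseteq> V \<and> (\<forall>u\<in>S. \<forall>v\<in>S. {u, v} \<notin> E)"

definition neighbors :: "'a set \<Rightarrow> 'a set set \<Rightarrow> 'a set \<Rightarrow> 'a set" where
  "neighbors V E U = {v \<in> V - U. \<exists>u\<in>U. {u, v} \<in> E}"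

end

theory Submission
  imports Defs
begin

text \<open>
  If \<open>S\<close> is stable, an edge that covers a node of \<open>S\<close> has its other end in
  \<open>neighbors V E S\<close>, and the edges of one matching have different other ends; so a matching
  covers at most \<open>card (neighbors V E S)\<close> nodes of \<open>S\<close>, and necessity follows by summing.

  For sufficiency, let every node \<open>v\<close> choose a pair \<open>(f v, c v)\<close> of a neighbour and a colour
  below \<open>k\<close>, all pairs being different. Hall's theorem makes this possible: in a set \<open>X\<close> of
  nodes, those with no neighbour in \<open>X\<close> form a stable set \<open>S\<close>, and every other node of \<open>X\<close>
  is itself a neighbour of \<open>X\<close> lying outside \<open>neighbors V E S\<close>, so the stable-set condition
  alone gives Hall's condition for \<open>X\<close>. The edges \<open>{v, f v}\<close> with \<open>c v = i\<close> need not be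
  disjoint, because \<open>v\<close> can be met by its own edge and by those of its preimages under \<open>f\<close>.

  To repair this, each node should be either a leaf, using its edge \<open>{v, f v}\<close>, or a centre,
  that is, the image of a leaf. A node without preimages can be made a leaf, and so can a node
  all of whose preimages are centres; when no more leaves can be added, the undecided nodes
  form a set \<open>U\<close> on which \<open>f\<close> acts as a permutation (\<open>leaves_and_permutation\<close>). Edges from
  leaves to centres get the colour of their leaf; two of them can share only a centre, and then
  their colours differ. The cycles in \<open>U\<close>, the odd ones included, are covered by two matchings
  (\<open>permutation_two_matchings\<close>). These can share the colours 0 and 1 because \<open>U\<close> contains
  neither leaves nor centres; this is where \<open>k \<ge> 2\<close> enters.
\<close>

section \<open>Hall's theorem\<close>

text \<open>A set \<open>X\<close> of indices is tight if it attains equality in Hall's condition. If no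
  nonempty proper subset is tight, the condition survives the removal of one element from all
  sets; otherwise the problem splits at a tight set \<open>X\<close>, because the sets outside \<open>X\<close> can do
  without the elements reserved for \<open>X\<close>.\<close>

lemma hall_marriage:
  assumes "finite A" and "\<And>a. a \<in> A \<Longrightarrow> finite (\<Gamma> a)"
    and "\<And>X. X \<subseteq> A \<Longrightarrow> card X \<le> card (\<Union>(\<Gamma> ` X))"
  shows "\<exists>h. inj_on h A \<and> (\<forall>a\<in>A. h a \<in> \<Gamma> a)"
  using assms
proof (induction A arbitrary: \<Gamma> rule: finite_psubset_induct)
  case (psubset A)
  note fin = psubset.prems(1) and hall = psubset.prems(2)
  show ?case
  proof (cases "A = {}")
    case False
    then obtain a where a: "a \<in> A" by blast
    have "card {a} \<le> card (\<Union>(\<Gamma> ` {a}))" using hall a by blast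
    then obtain b where b: "b \<in> \<Gamma> a" by fastforce
    show ?thesis
    proof (cases "\<exists>X. X \<noteq> {} \<and> X \<subset> A \<and> card (\<Union>(\<Gamma> ` X)) = card X")
      case True
      then obtain X where X: "X \<noteq> {}" "X \<subset> A" "card (\<Union>(\<Gamma> ` X)) = card X" by blast
      define R where "R = \<Union>(\<Gamma> ` X)"
      have finX: "finite X" using X psubset.hyps by (meson finite_subset psubset_imp_subset)
      have "\<exists>h. inj_on h X \<and> (\<forall>a\<in>X. h a \<in> \<Gamma> a)"
        using X(2) by (intro psubset.IH fin hall) auto
      then obtain h where h: "inj_on h X" "\<And>a. a \<in> X \<Longrightarrow> h a \<in> \<Gamma> a" by blast
      have "\<exists>g. inj_on g (A - X) \<and> (\<forall>a\<in>A - X. g a \<in> \<Gamma> a - R)"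
      proof (rule psubset.IH)
        show "A - X \<subset> A" using X by blast
        show "finite (\<Gamma> a - R)" if "a \<in> A - X" for a using fin that by blast
        fix Y assume Y: "Y \<subseteq> A - X"
        have finY: "finite Y" using Y psubset.hyps by (meson finite_Diff finite_subset)
        have "card X + card Y = card (X \<union> Y)"
          using finX finY Y by (subst card_Un_disjoint) auto
        also have "\<dots> \<le> card (\<Union>(\<Gamma> ` (X \<union> Y)))" using X Y by (intro hall) blast
        also have "\<Union>(\<Gamma> ` (X \<union> Y)) = R \<union> \<Union>((\<lambda>a. \<Gamma> a - R) ` Y)"
          unfolding R_def by blast
        also have "card \<dots> \<le> card R + card (\<Union>((\<lambda>a. \<Gamma> a - R) ` Y))" by (rule card_Un_le)
        finally show "card Y \<le> card (\<Union>((\<lambda>a. \<Gamma> a - R) ` Y))"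
          using X(3) unfolding R_def by simp
      qed
      then obtain g where g: "inj_on g (A - X)" "\<And>a. a \<in> A - X \<Longrightarrow> g a \<in> \<Gamma> a - R" by blast
      define m where "m x = (if x \<in> X then h x else g x)" for x
      have hR: "h x \<in> R" if "x \<in> X" for x using h that unfolding R_def by blast
      have "inj_on m A"
      proof (rule inj_onI)
        fix x y assume "x \<in> A" "y \<in> A" "m x = m y"
        then show "x = y"
          using hR g(2) inj_onD[OF h(1)] inj_onD[OF g(1)]
          unfolding m_def by (metis DiffE DiffI)
      qed
      moreover have "\<forall>x\<in>A. m x \<in> \<Gamma> x" using h g unfolding m_def by auto
      ultimately show ?thesis by blast
    next
      case False
      have "\<exists>g. inj_on g (A - {a}) \<and> (\<forall>x\<in>A - {a}. g x \<in> \<Gamma> x - {b})"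
      proof (rule psubset.IH)
        show "A - {a} \<subset> A" using a by blast
        show "finite (\<Gamma> x - {b})" if "x \<in> A - {a}" for x using fin that by blast
        fix Y assume Y: "Y \<subseteq> A - {a}"
        show "card Y \<le> card (\<Union>((\<lambda>x. \<Gamma> x - {b}) ` Y))"
        proof (cases "Y = {}")
          case ne: False
          have "card Y \<noteq> card (\<Union>(\<Gamma> ` Y))"
            using False ne Y a by (metis Diff_iff insertI1 psubsetI subset_iff)
          moreover have "card Y \<le> card (\<Union>(\<Gamma> ` Y))" using Y by (intro hall) blast
          ultimately have "card Y \<le> card (\<Union>(\<Gamma> ` Y)) - 1" by linarith
          also have "\<dots> \<le> card (\<Union>(\<Gamma> ` Y) - {b})"
            by (simp add: diff_card_le_card_Diff[of "{b}", simplified])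
          also have "\<Union>(\<Gamma> ` Y) - {b} = \<Union>((\<lambda>x. \<Gamma> x - {b}) ` Y)" by blast
          finally show ?thesis .
        qed simp
      qed
      then obtain g where g: "inj_on g (A - {a})" "\<And>x. x \<in> A - {a} \<Longrightarrow> g x \<in> \<Gamma> x - {b}" by blast
      have "inj_on (g(a := b)) A"
      proof (rule inj_onI)
        fix x y assume "x \<in> A" "y \<in> A" "(g(a := b)) x = (g(a := b)) y"
        then show "x = y"
          using g(2)[of x] g(2)[of y] inj_onD[OF g(1), of x y] by (auto split: if_splits)
      qed
      moreover have "\<forall>x\<in>A. (g(a := b)) x \<in> \<Gamma> x" using g b by auto
      ultimately show ?thesis by blast
    qed
  qed simp
qed

section \<open>Necessity\<close>

text \<open>Each covered node of \<open>S\<close> is sent to the other end of its matching edge, which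
  determines the edge and hence, because \<open>S\<close> is stable, the node.\<close>

lemma matching_covers_stable_le_neighbors:
  assumes G: "simple_graph V E" and M: "matching_in E M" and S: "stable_set V E S"
  shows "card {v \<in> S. covers M v} \<le> card (neighbors V E S)"
proof -
  have ex: "\<exists>w. {v, w} \<in> M \<and> w \<in> neighbors V E S" if vS: "v \<in> S" and vM: "covers M v" for v
  proof -
    obtain e where e: "e \<in> M" "v \<in> e" using vM unfolding covers_def by blast
    then have eE: "e \<in> E" using M unfolding matching_in_def by blast
    then have "card e = 2" "e \<subseteq> V" using G unfolding simple_graph_def by auto
    then obtain w where w: "e = {v, w}" "w \<in> V"
      using e(2) by (auto simp: card_2_iff)
    then have "w \<notin> S" using S vS eE unfolding stable_set_def by blast
    then show ?thesis using w e eE vS unfolding neighbors_def by blast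
  qed
  then obtain p where p: "\<And>v. v \<in> S \<Longrightarrow> covers M v \<Longrightarrow> {v, p v} \<in> M \<and> p v \<in> neighbors V E S"
    by metis
  have "inj_on p {v \<in> S. covers M v}"
  proof (rule inj_onI, clarsimp)
    fix x y assume xy: "x \<in> S" "covers M x" "y \<in> S" "covers M y" "p x = p y"
    have "{x, p x} \<in> M" "{y, p x} \<in> M" using p xy by metis+
    moreover have "\<not> disjnt {x, p x} {y, p x}" by (simp add: disjnt_def)
    ultimately have eq: "{x, p x} = {y, p x}"
      using M pairwiseD[of disjnt M] unfolding matching_in_def by metis
    have "p x \<notin> S" using p xy unfolding neighbors_def by blast
    then show "x = y" using eq xy by (metis doubleton_eq_iff)
  qed
  moreover have "finite (neighbors V E S)"
    using G unfolding simple_graph_def neighbors_def by auto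
  ultimately show ?thesis using p by (intro card_inj_on_le[of p]) auto
qed

lemma matching_cover_imp_stable_bound:
  assumes G: "simple_graph V E" and M: "matching_cover k V E M" and S: "stable_set V E S"
  shows "card S \<le> k * card (neighbors V E S)"
proof -
  have "finite S" using G S finite_subset unfolding simple_graph_def stable_set_def by blast
  moreover have "S \<subseteq> (\<Union>i<k. {v \<in> S. covers (M i) v})"
    using M S unfolding matching_cover_def stable_set_def covers_def by fastforce
  ultimately have "card S \<le> card (\<Union>i<k. {v \<in> S. covers (M i) v})"
    by (intro card_mono) auto
  also have "\<dots> \<le> (\<Sum>i<k. card {v \<in> S. covers (M i) v})" by (rule card_UN_le) simp
  also have "\<dots> \<le> (\<Sum>i<k. card (neighbors V E S))"
    using M S G unfolding matching_cover_def
    by (intro sum_mono matching_covers_stable_le_neighbors) auto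
  finally show ?thesis by simp
qed

section \<open>Choosing neighbours and colours\<close>

text \<open>The factor \<open>k\<close> in the bound is the number of colours available at each neighbour.
  It serves the nodes of a set \<open>X\<close> that have no neighbours in \<open>X\<close>; the other nodes of \<open>X\<close>
  are neighbours of \<open>X\<close> themselves, so they fit even with one colour each.\<close>

lemma neighbor_color_choice:
  fixes k :: nat
  assumes G: "simple_graph V E"
    and bound: "\<And>S. stable_set V E S \<Longrightarrow> card S \<le> k * card (neighbors V E S)"
    and k: "k \<ge> 1"
  shows "\<exists>f c. inj_on (\<lambda>v. (f v, c v)) V \<and> (\<forall>v\<in>V. {v, f v} \<in> E \<and> c v < k)"
proof -
  have V: "finite V" and E: "\<And>e. e \<in> E \<Longrightarrow> e \<subseteq> V" using G unfolding simple_graph_def by auto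
  define nb where "nb v = {w. {v, w} \<in> E}" for v
  have "\<exists>h. inj_on h V \<and> (\<forall>v\<in>V. h v \<in> nb v \<times> {..<k})"
  proof (rule hall_marriage)
    show "finite V" by (rule V)
    have nbV: "nb v \<subseteq> V" for v using E unfolding nb_def by blast
    show "finite (nb v \<times> {..<k})" for v using nbV V finite_subset by blast
    fix X assume X: "X \<subseteq> V"
    define S where "S = {v \<in> X. nb v \<inter> X = {}}"
    have fX: "finite X" using X V finite_subset by blast
    have "stable_set V E S" using X unfolding stable_set_def S_def nb_def by blast
    then have "card S \<le> k * card (neighbors V E S)" by (rule bound)
    moreover have "card (X - S) \<le> k * card (X - S)"
      using mult_le_mono1[OF k, of "card (X - S)"] by simp
    ultimately have "card S + card (X - S) \<le> k * (card (neighbors V E S) + card (X - S))"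
      by (simp only: distrib_left add_mono)
    also have "card S + card (X - S) = card X"
      using fX card_mono[of X S] by (subst card_Diff_subset) (auto simp: S_def)
    also have "card (neighbors V E S) + card (X - S) = card (neighbors V E S \<union> (X - S))"
      using V fX by (intro card_Un_disjoint[symmetric]) (auto simp: neighbors_def S_def nb_def)
    also have "\<dots> \<le> card (\<Union>(nb ` X))"
    proof (rule card_mono)
      show "finite (\<Union>(nb ` X))" using nbV V by (meson UN_least finite_subset)
      show "neighbors V E S \<union> (X - S) \<subseteq> \<Union>(nb ` X)"
        unfolding neighbors_def S_def nb_def by (fastforce simp: insert_commute)
    qed
    also have "k * card (\<Union>(nb ` X)) = card (\<Union>((\<lambda>v. nb v \<times> {..<k}) ` X))"
    proof -
      have "\<Union>((\<lambda>v. nb v \<times> {..<k}) ` X) = \<Union>(nb ` X) \<times> {..<k}" by blast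
      then show ?thesis by (simp add: card_cartesian_product)
    qed
    finally show "card X \<le> card (\<Union>((\<lambda>v. nb v \<times> {..<k}) ` X))" by simp
  qed
  then obtain h where h: "inj_on h V" "\<And>v. v \<in> V \<Longrightarrow> h v \<in> nb v \<times> {..<k}" by blast
  then have "inj_on (\<lambda>v. (fst (h v), snd (h v))) V \<and>
      (\<forall>v\<in>V. {v, fst (h v)} \<in> E \<and> snd (h v) < k)"
    unfolding nb_def by (auto simp: mem_Times_iff)
  then show ?thesis by (intro exI[of _ "fst \<circ> h"] exI[of _ "snd \<circ> h"]) simp
qed

section \<open>Leaves, centres and cycles of a self-map\<close>

lemma finite_maximal_subset:
  assumes "finite A" and "P {}"
  obtains L where "L \<subseteq> A" and "P L" and "\<And>x. x \<in> A - L \<Longrightarrow> \<not> P (insert x L)"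
proof -
  have "finite {L. L \<subseteq> A \<and> P L}" using assms by simp
  moreover have "{} \<in> {L. L \<subseteq> A \<and> P L}" using assms by simp
  ultimately obtain L where L: "L \<in> {L. L \<subseteq> A \<and> P L}"
    "\<And>Y. Y \<in> {L. L \<subseteq> A \<and> P L} \<Longrightarrow> L \<subseteq> Y \<Longrightarrow> L = Y"
    using finite_has_maximal[of "{L. L \<subseteq> A \<and> P L}"] by (metis (no_types, lifting) empty_iff)
  show ?thesis
  proof (rule that[of L])
    show "L \<subseteq> A" "P L" using L(1) by auto
    show "\<not> P (insert x L)" if "x \<in> A - L" for x using that L(1) L(2)[of "insert x L"] by blast
  qed
qed

text \<open>The leaves \<open>L\<close> are a maximal subset that is disjoint from the set \<open>f ` L\<close> of centres and
  contains only nodes all of whose preimages are centres. An undecided node without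
  undecided preimages has only centres as preimages and could be added to \<open>L\<close>. So \<open>f\<close> maps
  the undecided nodes onto a superset of themselves, and as they are finitely many, it
  permutes them.\<close>

lemma leaves_and_permutation:
  assumes "finite A" and "f ` A \<subseteq> A" and "\<And>a. a \<in> A \<Longrightarrow> f a \<noteq> a"
  obtains L where "L \<subseteq> A" and "L \<inter> f ` L = {}"
    and "inj_on f (A - L - f ` L)" and "f ` (A - L - f ` L) = A - L - f ` L"
proof -
  define P where "P L \<longleftrightarrow> L \<inter> f ` L = {} \<and> (\<forall>w\<in>A. f w \<in> L \<longrightarrow> w \<in> f ` L)" for L
  obtain L where L: "L \<subseteq> A" "P L" and max: "\<And>x. x \<in> A - L \<Longrightarrow> \<not> P (insert x L)"
    using finite_maximal_subset[OF assms(1), of P] unfolding P_def by auto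
  define U where "U = A - L - f ` L"
  have "U \<subseteq> f ` U"
  proof
    fix u assume u: "u \<in> U"
    show "u \<in> f ` U"
    proof (rule ccontr)
      assume no: "u \<notin> f ` U"
      have "w \<in> f ` L" if "w \<in> A" "f w = u" for w
        using that no u unfolding U_def by blast
      then have "P (insert u L)"
        using L u assms(3)[of u] unfolding P_def U_def by auto
      then show False using max u unfolding U_def by blast
    qed
  qed
  moreover have "finite U" using assms(1) unfolding U_def by simp
  ultimately have *: "f ` U = U"
    using card_image_le[of U f] card_seteq[of "f ` U" U] by auto
  then have "inj_on f U" using \<open>finite U\<close> by (simp add: eq_card_imp_inj_on)
  with * L show ?thesis unfolding U_def P_def by (intro that[of L]) auto
qed

lemma matching_in_edge_image:
  assumes "\<And>x. x \<in> X \<Longrightarrow> {x, f x} \<in> E" and "inj_on f X" and "X \<inter> f ` X = {}"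
  shows "matching_in E ((\<lambda>x. {x, f x}) ` X)"
  unfolding matching_in_def
proof (intro conjI pairwiseI)
  show "(\<lambda>x. {x, f x}) ` X \<subseteq> E" using assms(1) by blast
  fix d e assume "d \<in> (\<lambda>x. {x, f x}) ` X" "e \<in> (\<lambda>x. {x, f x}) ` X" "d \<noteq> e"
  then obtain x y where xy: "x \<in> X" "y \<in> X" "d = {x, f x}" "e = {y, f y}" "x \<noteq> y" by blast
  moreover have "f x \<noteq> f y" using xy inj_onD[OF assms(2)] by blast
  moreover have "f x \<noteq> y" "f y \<noteq> x" using xy assms(3) by blast+
  ultimately show "disjnt d e" by (simp add: disjnt_def)
qed

text \<open>The edges leaving a maximal set \<open>N\<close> with \<open>f ` N\<close> disjoint from \<open>N\<close> form one matching, the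
  edges entering it another, because \<open>f\<close> is injective and no edge \<open>{u, f u}\<close> has both ends in \<open>N\<close>. A node
  missed by both could be added to \<open>N\<close>.\<close>

lemma permutation_two_matchings:
  assumes "finite U" and f: "inj_on f U" "f ` U = U"
    and edge: "\<And>u. u \<in> U \<Longrightarrow> {u, f u} \<in> E \<and> f u \<noteq> u"
  obtains M0 M1 where "matching_in E M0" and "matching_in E M1"
    and "\<Union>M0 \<union> \<Union>M1 = U"
proof -
  obtain N where N: "N \<subseteq> U" "N \<inter> f ` N = {}"
    and max: "\<And>x. x \<in> U - N \<Longrightarrow> insert x N \<inter> f ` insert x N \<noteq> {}"
    using finite_maximal_subset[OF assms(1), of "\<lambda>N. N \<inter> f ` N = {}"] by auto
  define M0 where "M0 = (\<lambda>u. {u, f u}) ` N"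
  define M1 where "M1 = (\<lambda>u. {u, f u}) ` {u \<in> U. f u \<in> N}"
  have "matching_in E M0" unfolding M0_def
    using N edge inj_on_subset[OF f(1)] by (intro matching_in_edge_image) auto
  moreover have "matching_in E M1" unfolding M1_def
    using N edge inj_on_subset[OF f(1)] by (intro matching_in_edge_image) auto
  moreover have "u \<in> \<Union>M0 \<union> \<Union>M1" if u: "u \<in> U" for u
  proof (cases "u \<in> N \<or> u \<in> f ` N \<or> f u \<in> N")
    case True
    then show ?thesis using u unfolding M0_def M1_def by auto
  next
    case False
    then show ?thesis using max[of u] u edge[OF u] N by auto
  qed
  moreover have "\<Union>M0 \<union> \<Union>M1 \<subseteq> U" using N f(2) unfolding M0_def M1_def by auto
  ultimately show ?thesis using that by blast
qed

section \<open>Sufficiency\<close>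

lemma matching_in_Un:
  assumes "matching_in E M" and "matching_in E M'" and "\<Union>M \<inter> \<Union>M' = {}"
  shows "matching_in E (M \<union> M')"
proof -
  have cross: "disjnt d e" if "d \<in> M" "e \<in> M'" for d e
    using that assms(3) unfolding disjnt_def by blast
  then have "disjnt e d" if "d \<in> M" "e \<in> M'" for d e
    using that by (simp add: disjnt_sym)
  with cross show ?thesis
    using assms(1,2) unfolding matching_in_def by (simp add: pairwise_def) (meson UnE)
qed

lemma stable_bound_imp_matching_cover:
  fixes k :: nat
  assumes G: "simple_graph V E" and k: "k \<ge> 2"
    and bound: "\<And>S. stable_set V E S \<Longrightarrow> card S \<le> k * card (neighbors V E S)"
  shows "\<exists>M. matching_cover k V E M"
proof -
  have finV: "finite V" using G unfolding simple_graph_def by blast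
  obtain f c where fc: "inj_on (\<lambda>v. (f v, c v)) V"
    and edge: "\<And>v. v \<in> V \<Longrightarrow> {v, f v} \<in> E" and ck: "\<And>v. v \<in> V \<Longrightarrow> c v < k"
    using neighbor_color_choice[OF G bound] k by fastforce
  have fne: "f v \<noteq> v" and fV: "f v \<in> V" if "v \<in> V" for v
    using edge[OF that] G unfolding simple_graph_def by fastforce+
  obtain L where L: "L \<subseteq> V" "L \<inter> f ` L = {}"
    and perm: "inj_on f (V - L - f ` L)" "f ` (V - L - f ` L) = V - L - f ` L"
    using leaves_and_permutation[OF finV, of f] fne fV by blast
  define U where "U = V - L - f ` L"
  obtain M0 M1 where M01: "matching_in E M0" "matching_in E M1" "\<Union>M0 \<union> \<Union>M1 = U"
  proof (rule permutation_two_matchings)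
    show "finite U" using finV unfolding U_def by simp
    show "inj_on f U" "f ` U = U" using perm unfolding U_def by auto
    show "{u, f u} \<in> E \<and> f u \<noteq> u" if "u \<in> U" for u
      using that edge fne unfolding U_def by blast
  qed
  define B where "B i = (if i = 0 then M0 else if i = 1 then M1 else {})" for i :: nat
  define M where "M i = (\<lambda>v. {v, f v}) ` {v \<in> L. c v = i} \<union> B i" for i
  have "matching_in E (M i)" for i unfolding M_def
  proof (rule matching_in_Un)
    show "matching_in E ((\<lambda>v. {v, f v}) ` {v \<in> L. c v = i})"
    proof (rule matching_in_edge_image)
      show "inj_on f {v \<in> L. c v = i}" using fc L(1) unfolding inj_on_def by blast
    qed (use edge L in auto)
    show "matching_in E (B i)" using M01 unfolding B_def by (auto simp: matching_in_def)
    have "\<Union>(B i) \<subseteq> U" using M01(3) unfolding B_def by auto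
    then show "\<Union>((\<lambda>v. {v, f v}) ` {v \<in> L. c v = i}) \<inter> \<Union>(B i) = {}" unfolding U_def by auto
  qed
  moreover have "covers (\<Union>i<k. M i) v" if v: "v \<in> V" for v
  proof (cases "v \<in> U")
    case True
    then have "v \<in> \<Union>(B 0) \<or> v \<in> \<Union>(B 1)" using M01(3) unfolding B_def by auto
    moreover have "0 < k" "1 < k" using k by auto
    ultimately show ?thesis unfolding covers_def M_def by blast
  next
    case False
    then obtain u where "u \<in> L" "v \<in> {u, f u}" using v unfolding U_def by blast
    then show ?thesis using ck[of u] L(1) unfolding covers_def M_def by blast
  qed
  ultimately show ?thesis unfolding matching_cover_def by blast
qed

theorem theorem2:
  fixes V :: "'a set" and E :: "'a set set" and k :: nat
  assumes "connected_graph V E" and "k \<ge> 2"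
  shows "(\<exists>M. matching_cover k V E M) \<longleftrightarrow>
    (\<forall>S. stable_set V E S \<longrightarrow> card S \<le> k * card (neighbors V E S))"
proof -
  have "simple_graph V E" using assms(1) unfolding connected_graph_def by blast
  then show ?thesis
    using matching_cover_imp_stable_bound stable_bound_imp_matching_cover[OF _ assms(2)] by metis
qed

end
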